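(* Let $T\in\mathcal{BC}(X)$. For all $q,s\in\rho_S(T)$ with $s\notin[q]$ the following equation holds: $$S^{-1}_R(s,T)\mathcal P^L_2(q,T)+\mathcal P^R_2(s,T)S^{-1}_L(q,T)-\frac14\Big(\mathcal P_2^R(s,T)\,\underline T\,\mathcal P_2^L(q,T)+\mathcal P_2^R(s,T)\,\underline T^2F_L(q,T)+F_R(s,T)\,\underline T^2\mathcal P_2^L(q,T)+F_R(s,T)\,\underline T^3F_L(q,T)\Big)$$ $$=\big[(\mathcal P_2^R(s,T)-\mathcal P_2^L(q,T))q-\bar s(\mathcal P_2^R(s,T)-\mathcal P_2^L(q,T))\big]\mathcal Q_s(q)^{-1},$$ where $\mathcal Q_s(q):=q^2-2s_0q+|s|^2$ and $\underline T=T_1e_1+T_2e_2+T_3e_3$.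
   Context: $\mathbb H$ denotes the quaternions with units $e_1,e_2,e_3$; $s_0=\mathrm{Re}(s)$, and $[q]=\{q_0+J|\underline q| : J\in\mathbb S\}$ where $\underline q$ is the imaginary part of $q$ and $\mathbb S$ is the set of imaginary units ($J^2=-1$). $X=X_{\mathbb R}\otimes\mathbb H$ is a two-sided quaternionic Banach module, $X_{\mathbb R}$ a real Banach space; $\mathcal B(X)$ is the space of bounded right linear operators on $X$. For $a\in\mathbb H$ and $T\in\mathcal B(X)$, $(aT)(x)=a\,T(x)$ and $(Ta)(x)=T(ax)$. $\mathcal{BC}(X)\subset\mathcal B(X)$ is the set of operators $T=T_0+T_1e_1+T_2e_2+T_3e_3$ with pairwise commuting components $T_i\in\mathcal B(X_{\mathbb R})$; $\overline T=T_0-T_1e_1-T_2e_2-T_3e_3$. $S$-resolvent set: $\rho_S(T)=\{s\in\mathbb H: (T^2-2\mathrm{Re}(s)T+|s|^2\mathcal I)^{-1}\in\mathcal B(X)\}$. For $T\in\mathcal{BC}(X)$ it coincides with the set of $s\in\mathbb H$ for which $\mathcal Q_{c,s}(T):=s^2-s(T+\overline T)+T\overline T$ is invertible in $\mathcal B(X)$. For $s\in\rho_S(T)$: $S^{-1}_L(s,T)=(s\mathcal I-\overline T)\mathcal Q_{c,s}(T)^{-1}$, $S^{-1}_R(s,T)=\mathcal Q_{c,s}(T)^{-1}(s\mathcal I-\overline T)$; $F_L(s,T)=-4(s\mathcal I-\overline T)\mathcal Q_{c,s}(T)^{-2}$, $F_R(s,T)=-4\mathcal Q_{c,s}(T)^{-2}(s\mathcal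 I-\overline T)$; $\mathcal P^L_2(s,T)=-F_L(s,T)s+T_0F_L(s,T)$, $\mathcal P^R_2(s,T)=-sF_R(s,T)+T_0F_R(s,T)$. *)

theory Defs
  imports "HOL-Analysis.Analysis"
begin

codatatype quat = Quat (q0: real) (q1: real) (q2: real) (q3: real)

lemma quat_eqI: "q0 a = q0 b \<Longrightarrow> q1 a = q1 b \<Longrightarrow> q2 a = q2 b \<Longrightarrow> q3 a = q3 b \<Longrightarrow> a = b"
  by (rule quat.expand) simp

lemma quat_eq_iff: "a = b \<longleftrightarrow> q0 a = q0 b \<and> q1 a = q1 b \<and> q2 a = q2 b \<and> q3 a = q3 b"
  by (auto intro: quat_eqI)

instantiation quat :: real_algebra_1
begin

primcorec zero_quat where
  "q0 0 = 0" | "q1 0 = 0" | "q2 0 = 0" | "q3 0 = 0"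

primcorec one_quat where
  "q0 1 = 1" | "q1 1 = 0" | "q2 1 = 0" | "q3 1 = 0"

primcorec plus_quat where
  "q0 (a + b) = q0 a + q0 b"
| "q1 (a + b) = q1 a + q1 b"
| "q2 (a + b) = q2 a + q2 b"
| "q3 (a + b) = q3 a + q3 b"

primcorec minus_quat where
  "q0 (a - b) = q0 a - q0 b"
| "q1 (a - b) = q1 a - q1 b"
| "q2 (a - b) = q2 a - q2 b"
| "q3 (a - b) = q3 a - q3 b"

primcorec uminus_quat where
  "q0 (- a) = - q0 a"
| "q1 (- a) = - q1 a"
| "q2 (- a) = - q2 a"
| "q3 (- a) = - q3 a"

primcorec times_quat where
  "q0 (a * b) = q0 a * q0 b - q1 a * q1 b - q2 a * q2 b - q3 a * q3 b"
| "q1 (a * b) = q0 a * q1 b + q1 a * q0 b + q2 a * q3 b - q3 a * q2 b"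
| "q2 (a * b) = q0 a * q2 b - q1 a * q3 b + q2 a * q0 b + q3 a * q1 b"
| "q3 (a * b) = q0 a * q3 b + q1 a * q2 b - q2 a * q1 b + q3 a * q0 b"

primcorec scaleR_quat where
  "q0 (r *\<^sub>R a) = r * q0 a"
| "q1 (r *\<^sub>R a) = r * q1 a"
| "q2 (r *\<^sub>R a) = r * q2 a"
| "q3 (r *\<^sub>R a) = r * q3 a"

instance
  by standard (simp_all add: quat_eq_iff algebra_simps)

end

definition qcnj :: "quat \<Rightarrow> quat" where
  "qcnj a = Quat (q0 a) (- q1 a) (- q2 a) (- q3 a)"

definition qIm :: "quat \<Rightarrow> quat" where
  "qIm a = Quat 0 (q1 a) (q2 a) (q3 a)"

definition e1 :: quat where "e1 = Quat 0 1 0 0"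
definition e2 :: quat where "e2 = Quat 0 0 1 0"
definition e3 :: quat where "e3 = Quat 0 0 0 1"

lemma quat_units:
  "e1 * e1 = -1" "e2 * e2 = -1" "e3 * e3 = -1"
  "e1 * e2 = e3" "e2 * e3 = e1" "e3 * e1 = e2"
  "e2 * e1 = - e3" "e3 * e2 = - e1" "e1 * e3 = - e2"
  by (simp_all add: quat_eq_iff e1_def e2_def e3_def)

instantiation quat :: real_normed_div_algebra
begin

definition norm_quat :: "quat \<Rightarrow> real" where
  "norm a = sqrt ((q0 a)\<^sup>2 + (q1 a)\<^sup>2 + (q2 a)\<^sup>2 + (q3 a)\<^sup>2)"

definition inverse_quat :: "quat \<Rightarrow> quat" where
  "inverse a = (1 / (norm a)\<^sup>2) *\<^sub>R qcnj a"

definition divide_quat :: "quat \<Rightarrow> quat \<Rightarrow> quat" where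
  "a div b = a * inverse b" for a b :: quat

definition dist_quat :: "quat \<Rightarrow> quat \<Rightarrow> real" where
  "dist a b = norm (a - b)" for a b :: quat

definition sgn_quat :: "quat \<Rightarrow> quat" where
  "sgn a = a /\<^sub>R norm a" for a :: quat

definition uniformity_quat :: "(quat \<times> quat) filter" where
  "uniformity_quat = (INF e\<in>{0<..}. principal {(x, y). dist x y < e})"

definition open_quat :: "quat set \<Rightarrow> bool" where
  "open_quat U \<longleftrightarrow> (\<forall>x\<in>U. eventually (\<lambda>(x', y). x' = x \<longrightarrow> y \<in> U) uniformity)"

instance
proof
  fix a b :: quat and r :: real and U :: "quat set"
  have sq: "(norm c)\<^sup>2 = (q0 c)\<^sup>2 + (q1 c)\<^sup>2 + (q2 c)\<^sup>2 + (q3 c)\<^sup>2" for c :: quat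
    unfolding norm_quat_def by simp
  have prd: "norm c = norm (q0 c, q1 c, q2 c, q3 c)" for c :: quat
    by (simp add: norm_quat_def norm_prod_def add_ac)
  show z: "norm a = 0 \<longleftrightarrow> a = 0" for a :: quat
    by (simp add: prd quat_eq_iff prod_eq_iff)
  show "norm (a + b) \<le> norm a + norm b"
    using norm_triangle_ineq[of "(q0 a, q1 a, q2 a, q3 a)" "(q0 b, q1 b, q2 b, q3 b)"]
    by (simp add: prd)
  show "norm (r *\<^sub>R a) = \<bar>r\<bar> * norm a"
    by (simp add: norm_quat_def power_mult_distrib real_sqrt_mult flip: distrib_left)
  show "norm (a * b) = norm a * norm b"
    unfolding norm_quat_def real_sqrt_mult[symmetric]
    by (rule arg_cong[where f = sqrt]) (simp add: power2_eq_square algebra_simps)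
  have nz: "(norm a)\<^sup>2 \<noteq> 0" if "a \<noteq> 0"
    using that z by simp
  have cnj: "qcnj a * a = (norm a)\<^sup>2 *\<^sub>R 1" "a * qcnj a = (norm a)\<^sup>2 *\<^sub>R 1"
    unfolding sq by (simp_all add: quat_eq_iff qcnj_def power2_eq_square)
  show "inverse a * a = 1" "a * inverse a = 1" if "a \<noteq> 0"
    using nz[OF that] by (simp_all add: inverse_quat_def cnj)
  show "inverse (0::quat) = 0"
    by (simp add: inverse_quat_def quat_eq_iff qcnj_def)
qed (simp_all add: divide_quat_def dist_quat_def sgn_quat_def uniformity_quat_def open_quat_def)

end

definition qsphere :: "quat \<Rightarrow> quat set" where
  "qsphere q = {of_real (q0 q) + J * of_real (norm (qIm q)) | J. J\<^sup>2 = -1}"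

text \<open>
  \<open>X = X\<^sub>\<real> \<otimes> \<H>\<close>: the vector \<open>x\<^sub>0 + x\<^sub>1 e\<^sub>1 + x\<^sub>2 e\<^sub>2 + x\<^sub>3 e\<^sub>3\<close> with \<open>x\<^sub>i\<close> in the real Banach space \<open>'x\<close> is the
  quadruple \<open>(x\<^sub>0, x\<^sub>1, x\<^sub>2, x\<^sub>3)\<close>. The library norm on products is
  \<open>\<parallel>x\<parallel>\<^sup>2 = \<parallel>x\<^sub>0\<parallel>\<^sup>2 + \<parallel>x\<^sub>1\<parallel>\<^sup>2 + \<parallel>x\<^sub>2\<parallel>\<^sup>2 + \<parallel>x\<^sub>3\<parallel>\<^sup>2\<close>; equivalent norms give the same bounded operators.
\<close>

type_synonym 'x qmod = "'x \<times> 'x \<times> 'x \<times> 'x"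

fun lmult :: "quat \<Rightarrow> 'x::real_vector qmod \<Rightarrow> 'x qmod" where
  "lmult a (x0, x1, x2, x3) =
     (q0 a *\<^sub>R x0 - q1 a *\<^sub>R x1 - q2 a *\<^sub>R x2 - q3 a *\<^sub>R x3,
      q0 a *\<^sub>R x1 + q1 a *\<^sub>R x0 + q2 a *\<^sub>R x3 - q3 a *\<^sub>R x2,
      q0 a *\<^sub>R x2 - q1 a *\<^sub>R x3 + q2 a *\<^sub>R x0 + q3 a *\<^sub>R x1,
      q0 a *\<^sub>R x3 + q1 a *\<^sub>R x2 - q2 a *\<^sub>R x1 + q3 a *\<^sub>R x0)"

fun rmult :: "'x::real_vector qmod \<Rightarrow> quat \<Rightarrow> 'x qmod" where
  "rmult (x0, x1, x2, x3) a =
     (q0 a *\<^sub>R x0 - q1 a *\<^sub>R x1 - q2 a *\<^sub>R x2 - q3 a *\<^sub>R x3,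
      q1 a *\<^sub>R x0 + q0 a *\<^sub>R x1 + q3 a *\<^sub>R x2 - q2 a *\<^sub>R x3,
      q2 a *\<^sub>R x0 - q3 a *\<^sub>R x1 + q0 a *\<^sub>R x2 + q1 a *\<^sub>R x3,
      q3 a *\<^sub>R x0 + q2 a *\<^sub>R x1 - q1 a *\<^sub>R x2 + q0 a *\<^sub>R x3)"

lemma lmult_mult: "lmult (a * b) x = lmult a (lmult b x)"
  by (cases x) (simp add: algebra_simps)

lemma rmult_mult: "rmult x (a * b) = rmult (rmult x a) b"
  by (cases x) (simp add: algebra_simps)

lemma lmult_rmult: "lmult a (rmult x b) = rmult (lmult a x) b"
  by (cases x) (simp add: algebra_simps)

lemma mult_one [simp]: "lmult 1 x = x" "rmult x 1 = x"
  by (cases x, simp)+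

lemma mult_of_real: "lmult (of_real r) x = r *\<^sub>R x" "rmult x (of_real r) = r *\<^sub>R x"
  by (cases x, simp add: of_real_def)+

lemma rmult_add: "rmult (x + y) a = rmult x a + rmult y a"
  by (cases x; cases y) (simp add: algebra_simps)

lemma rmult_diff: "rmult (x - y) a = rmult x a - rmult y a"
  by (cases x; cases y) (simp add: algebra_simps)

lemma rmult_minus: "rmult (- x) a = - rmult x a"
  by (cases x) (simp add: algebra_simps)

lemma rmult_zero: "rmult 0 a = 0"
  by (simp add: zero_prod_def)

lemma rmult_scaleR: "rmult (r *\<^sub>R x) a = r *\<^sub>R rmult x a"
  by (cases x) (simp add: algebra_simps)

lemma rmult_units:
  "rmult (v, 0, 0, 0) e1 = (0, v, 0, 0)"
  "rmult (v, 0, 0, 0) e2 = (0, 0, v, 0)"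
  "rmult (v, 0, 0, 0) e3 = (0, 0, 0, v)"
  by (simp_all add: e1_def e2_def e3_def)

lemma bounded_linear_lmult: "bounded_linear (lmult a :: 'x::real_normed_vector qmod \<Rightarrow> 'x qmod)"
proof -
  have "lmult a = (\<lambda>x :: 'x qmod.
     (q0 a *\<^sub>R fst x - q1 a *\<^sub>R fst (snd x) - q2 a *\<^sub>R fst (snd (snd x)) - q3 a *\<^sub>R snd (snd (snd x)),
      q0 a *\<^sub>R fst (snd x) + q1 a *\<^sub>R fst x + q2 a *\<^sub>R snd (snd (snd x)) - q3 a *\<^sub>R fst (snd (snd x)),
      q0 a *\<^sub>R fst (snd (snd x)) - q1 a *\<^sub>R snd (snd (snd x)) + q2 a *\<^sub>R fst x + q3 a *\<^sub>R fst (snd x),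
      q0 a *\<^sub>R snd (snd (snd x)) + q1 a *\<^sub>R fst (snd (snd x)) - q2 a *\<^sub>R fst (snd x) + q3 a *\<^sub>R fst x))"
    by (auto simp: fun_eq_iff)
  then show ?thesis
    by (auto intro!: bounded_linear_intros)
qed

text \<open>Additivity and real homogeneity are contained in \<^const>\<open>bounded_linear\<close>.\<close>

typedef (overloaded) 'x qop =
  "{f :: 'x::banach qmod \<Rightarrow> 'x qmod. bounded_linear f \<and> (\<forall>x a. f (rmult x a) = rmult (f x) a)}"
  morphisms qapp Qop
  by (rule exI[of _ "\<lambda>x. x"]) (simp add: bounded_linear_ident)

setup_lifting type_definition_qop

lemma qop_eqI: "(\<And>x. qapp A x = qapp B x) \<Longrightarrow> A = B"
  by (simp add: qapp_inject[symmetric] fun_eq_iff del: split_paired_All)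

instantiation qop :: (banach) real_algebra
begin

lift_definition zero_qop :: "'a qop" is "\<lambda>x. 0"
  by (simp add: rmult_zero)

lift_definition plus_qop :: "'a qop \<Rightarrow> 'a qop \<Rightarrow> 'a qop" is "\<lambda>f g x. f x + g x"
  by (simp add: bounded_linear_add rmult_add)

lift_definition minus_qop :: "'a qop \<Rightarrow> 'a qop \<Rightarrow> 'a qop" is "\<lambda>f g x. f x - g x"
  by (simp add: bounded_linear_sub rmult_diff)

lift_definition uminus_qop :: "'a qop \<Rightarrow> 'a qop" is "\<lambda>f x. - f x"
  by (simp add: bounded_linear_minus rmult_minus)

lift_definition times_qop :: "'a qop \<Rightarrow> 'a qop \<Rightarrow> 'a qop" is "\<lambda>f g x. f (g x)"
  by (simp add: bounded_linear_compose del: split_paired_All)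

lift_definition scaleR_qop :: "real \<Rightarrow> 'a qop \<Rightarrow> 'a qop" is "\<lambda>r f x. r *\<^sub>R f x"
  by (simp add: bounded_linear_const_scaleR rmult_scaleR)

instance
proof -
  note rep = zero_qop.rep_eq plus_qop.rep_eq minus_qop.rep_eq uminus_qop.rep_eq
    times_qop.rep_eq scaleR_qop.rep_eq
  have lin: "linear (qapp A)" for A :: "'a qop"
    using qapp[of A] by (simp add: bounded_linear.linear)
  note [simp] = rep linear_add[OF lin] linear_scale[OF lin]
  show "OFCLASS('a qop, real_algebra_class)"
    by standard (rule qop_eqI, simp add: algebra_simps)+
qed

end

text \<open>Not \<open>ring_1\<close>: the Banach space \<open>'x\<close> may be trivial.\<close>

instantiation qop :: (banach) monoid_mult
begin

lift_definition one_qop :: "'a qop" is "\<lambda>x. x"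
  by (simp add: bounded_linear_ident)

instance
  by standard (transfer; simp)+

end

lift_definition lscale :: "quat \<Rightarrow> 'x::banach qop \<Rightarrow> 'x qop"  (infixr \<open>\<rhd>\<close> 75)
  is "\<lambda>a f x. lmult a (f x)"
  by (simp add: bounded_linear_compose[OF bounded_linear_lmult] lmult_rmult)

lift_definition rscale :: "'x::banach qop \<Rightarrow> quat \<Rightarrow> 'x qop"  (infixl \<open>\<lhd>\<close> 75)
  is "\<lambda>f a x. f (lmult a x)"
  by (simp add: bounded_linear_compose[OF _ bounded_linear_lmult] lmult_rmult)

text \<open>
  The inclusion of \<open>\<B>(X\<^sub>\<real>)\<close> into \<open>\<B>(X)\<close>:
  \<open>A (x\<^sub>0 + x\<^sub>1 e\<^sub>1 + x\<^sub>2 e\<^sub>2 + x\<^sub>3 e\<^sub>3) = A x\<^sub>0 + A x\<^sub>1 e\<^sub>1 + A x\<^sub>2 e\<^sub>2 + A x\<^sub>3 e\<^sub>3\<close>.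
\<close>

lift_definition ext :: "('x::banach \<Rightarrow>\<^sub>L 'x) \<Rightarrow> 'x qop"
  is "\<lambda>A x. (A (fst x), A (fst (snd x)), A (fst (snd (snd x))), A (snd (snd (snd x))))"
proof (safe, goal_cases)
  case (1 A)
  then show ?case
    by (intro bounded_linear_Pair bounded_linear_compose[OF 1] bounded_linear_intros)
next
  case (2 A)
  then interpret bounded_linear A .
  show ?case
    by (simp add: add diff scaleR)
qed

text \<open>The components \<open>T\<^sub>0, T\<^sub>1, T\<^sub>2, T\<^sub>3\<close> of \<open>T\<close> are those of its restriction to \<open>X\<^sub>\<real>\<close>.\<close>

lemma bounded_linear_restrict:
  fixes f :: "'x::real_normed_vector qmod \<Rightarrow> 'x qmod"
  assumes "bounded_linear f"
  shows "bounded_linear (\<lambda>v. fst (f (v, 0, 0, 0)))"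
    "bounded_linear (\<lambda>v. fst (snd (f (v, 0, 0, 0))))"
    "bounded_linear (\<lambda>v. fst (snd (snd (f (v, 0, 0, 0)))))"
    "bounded_linear (\<lambda>v. snd (snd (snd (f (v, 0, 0, 0)))))"
proof -
  have "bounded_linear (\<lambda>v :: 'x. (v, 0 :: 'x, 0 :: 'x, 0 :: 'x))"
    by (intro bounded_linear_Pair bounded_linear_ident bounded_linear_zero)
  note 0 = bounded_linear_compose[OF assms this]
  note 1 = bounded_linear_compose[OF bounded_linear_snd 0]
  note 2 = bounded_linear_compose[OF bounded_linear_snd 1]
  note fst = bounded_linear_compose[OF bounded_linear_fst]
  show "bounded_linear (\<lambda>v. fst (f (v, 0, 0, 0)))"
    by (rule fst[OF 0])
  show "bounded_linear (\<lambda>v. fst (snd (f (v, 0, 0, 0))))"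
    by (rule fst[OF 1])
  show "bounded_linear (\<lambda>v. fst (snd (snd (f (v, 0, 0, 0)))))"
    by (rule fst[OF 2])
  show "bounded_linear (\<lambda>v. snd (snd (snd (f (v, 0, 0, 0)))))"
    by (rule bounded_linear_compose[OF bounded_linear_snd 2])
qed

lift_definition comp0 :: "'x::banach qop \<Rightarrow> 'x \<Rightarrow>\<^sub>L 'x" is "\<lambda>f v. fst (f (v, 0, 0, 0))"
  by (simp add: bounded_linear_restrict del: split_paired_All)

lift_definition comp1 :: "'x::banach qop \<Rightarrow> 'x \<Rightarrow>\<^sub>L 'x" is "\<lambda>f v. fst (snd (f (v, 0, 0, 0)))"
  by (simp add: bounded_linear_restrict del: split_paired_All)

lift_definition comp2 :: "'x::banach qop \<Rightarrow> 'x \<Rightarrow>\<^sub>L 'x" is "\<lambda>f v. fst (snd (snd (f (v, 0, 0, 0))))"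
  by (simp add: bounded_linear_restrict del: split_paired_All)

lift_definition comp3 :: "'x::banach qop \<Rightarrow> 'x \<Rightarrow>\<^sub>L 'x" is "\<lambda>f v. snd (snd (snd (f (v, 0, 0, 0))))"
  by (simp add: bounded_linear_restrict del: split_paired_All)

lemma qop_decomp:
  "T = ext (comp0 T) + ext (comp1 T) \<lhd> e1 + ext (comp2 T) \<lhd> e2 + ext (comp3 T) \<lhd> e3"
proof (rule qop_eqI)
  fix x :: "'a qmod"
  interpret bounded_linear "qapp T"
    using qapp[of T] by simp
  have T: "qapp T (rmult x a) = rmult (qapp T x) a" for x a
    using qapp[of T] by blast
  obtain x0 x1 x2 x3 where x: "x = (x0, x1, x2, x3)"
    by (cases x)
  have split: "x = (x0, 0, 0, 0) + rmult (x1, 0, 0, 0) e1 + rmult (x2, 0, 0, 0) e2 + rmult (x3, 0, 0, 0) e3"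
    unfolding x rmult_units by simp
  have neg: "qapp T (- v, 0, 0, 0) = - qapp T (v, 0, 0, 0)" for v
    using linear_neg[OF bounded_linear.linear, of "qapp T" "(v, 0, 0, 0)"] bounded_linear_axioms by simp
  have 0: "qapp T (0, 0, 0, 0) = 0"
    using zero by (simp add: zero_prod_def)
  obtain a0 a1 a2 a3 where T0: "qapp T (x0, 0, 0, 0) = (a0, a1, a2, a3)"
    by (rule prod_cases4)
  obtain b0 b1 b2 b3 where T1: "qapp T (x1, 0, 0, 0) = (b0, b1, b2, b3)"
    by (rule prod_cases4)
  obtain c0 c1 c2 c3 where T2: "qapp T (x2, 0, 0, 0) = (c0, c1, c2, c3)"
    by (rule prod_cases4)
  obtain d0 d1 d2 d3 where T3: "qapp T (x3, 0, 0, 0) = (d0, d1, d2, d3)"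
    by (rule prod_cases4)
  have "qapp T x = qapp T (x0, 0, 0, 0) + rmult (qapp T (x1, 0, 0, 0)) e1
      + rmult (qapp T (x2, 0, 0, 0)) e2 + rmult (qapp T (x3, 0, 0, 0)) e3"
    unfolding split by (simp only: add T)
  then show "qapp T x = qapp (ext (comp0 T) + ext (comp1 T) \<lhd> e1 + ext (comp2 T) \<lhd> e2 + ext (comp3 T) \<lhd> e3) x"
    by (simp add: T0 T1 T2 T3 x plus_qop.rep_eq rscale.rep_eq ext.rep_eq comp0.rep_eq comp1.rep_eq comp2.rep_eq
        comp3.rep_eq neg e1_def e2_def e3_def)
qed

lemma comp_ext:
  assumes "T = ext T0 + ext T1 \<lhd> e1 + ext T2 \<lhd> e2 + ext T3 \<lhd> e3"
  shows "comp0 T = T0" "comp1 T = T1" "comp2 T = T2" "comp3 T = T3"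
proof -
  note [simp] = assms plus_qop.rep_eq rscale.rep_eq ext.rep_eq comp0.rep_eq comp1.rep_eq
    comp2.rep_eq comp3.rep_eq e1_def e2_def e3_def
  show "comp0 T = T0"
    by (rule blinfun_eqI) simp
  show "comp1 T = T1"
    by (rule blinfun_eqI) simp
  show "comp2 T = T2"
    by (rule blinfun_eqI) simp
  show "comp3 T = T3"
    by (rule blinfun_eqI) simp
qed

definition BC :: "'x::banach qop set" where
  "BC = {T. \<exists>T0 T1 T2 T3.
          T = ext T0 + ext T1 \<lhd> e1 + ext T2 \<lhd> e2 + ext T3 \<lhd> e3 \<and>
          (\<forall>A\<in>{T0, T1, T2, T3}. \<forall>B\<in>{T0, T1, T2, T3}. A o\<^sub>L B = B o\<^sub>L A)}"

definition opRe :: "'x::banach qop \<Rightarrow> 'x qop" where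
  "opRe T = ext (comp0 T)"

definition opIm :: "'x::banach qop \<Rightarrow> 'x qop" where
  "opIm T = ext (comp1 T) \<lhd> e1 + ext (comp2 T) \<lhd> e2 + ext (comp3 T) \<lhd> e3"

definition opcnj :: "'x::banach qop \<Rightarrow> 'x qop" where
  "opcnj T = ext (comp0 T) - ext (comp1 T) \<lhd> e1 - ext (comp2 T) \<lhd> e2 - ext (comp3 T) \<lhd> e3"

definition op_invertible :: "'x::banach qop \<Rightarrow> bool" where
  "op_invertible A \<longleftrightarrow> (\<exists>B. A * B = 1 \<and> B * A = 1)"

text \<open>Meaningful only for invertible \<open>A\<close>.\<close>

definition op_inv :: "'x::banach qop \<Rightarrow> 'x qop" where
  "op_inv A = (THE B. A * B = 1 \<and> B * A = 1)"

lemma op_inv: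
  assumes "op_invertible A"
  shows "A * op_inv A = 1" "op_inv A * A = 1"
proof -
  have "\<exists>!B. A * B = 1 \<and> B * A = 1"
  proof -
    obtain B where B: "A * B = 1" "B * A = 1"
      using assms by (auto simp: op_invertible_def)
    have "C = B" if "A * C = 1" for C
    proof -
      have "C = (B * A) * C" by (simp add: B)
      also have "\<dots> = B * (A * C)" by (rule mult.assoc)
      finally show ?thesis by (simp add: that)
    qed
    with B show ?thesis by blast
  qed
  from theI'[OF this] show "A * op_inv A = 1" "op_inv A * A = 1"
    by (simp_all add: op_inv_def)
qed

definition rho_S :: "'x::banach qop \<Rightarrow> quat set" where
  "rho_S T = {s. op_invertible (T\<^sup>2 - (2 * q0 s) *\<^sub>R T + (norm s)\<^sup>2 *\<^sub>R 1)}"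

definition Q_c :: "quat \<Rightarrow> 'x::banach qop \<Rightarrow> 'x qop" where
  "Q_c s T = s\<^sup>2 \<rhd> 1 - s \<rhd> (T + opcnj T) + T * opcnj T"

definition S_L_inv :: "quat \<Rightarrow> 'x::banach qop \<Rightarrow> 'x qop" where
  "S_L_inv s T = (s \<rhd> 1 - opcnj T) * op_inv (Q_c s T)"

definition S_R_inv :: "quat \<Rightarrow> 'x::banach qop \<Rightarrow> 'x qop" where
  "S_R_inv s T = op_inv (Q_c s T) * (s \<rhd> 1 - opcnj T)"

definition F_L :: "quat \<Rightarrow> 'x::banach qop \<Rightarrow> 'x qop" where
  "F_L s T = (-4) *\<^sub>R ((s \<rhd> 1 - opcnj T) * (op_inv (Q_c s T))\<^sup>2)"

definition F_R :: "quat \<Rightarrow> 'x::banach qop \<Rightarrow> 'x qop" where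
  "F_R s T = (-4) *\<^sub>R ((op_inv (Q_c s T))\<^sup>2 * (s \<rhd> 1 - opcnj T))"

definition P2_L :: "quat \<Rightarrow> 'x::banach qop \<Rightarrow> 'x qop" where
  "P2_L s T = - (F_L s T \<lhd> s) + opRe T * F_L s T"

definition P2_R :: "quat \<Rightarrow> 'x::banach qop \<Rightarrow> 'x qop" where
  "P2_R s T = - (s \<rhd> F_R s T) + opRe T * F_R s T"

definition Q_s :: "quat \<Rightarrow> quat \<Rightarrow> quat" where
  "Q_s s q = q\<^sup>2 - of_real (2 * q0 s) * q + of_real ((norm s)\<^sup>2)"

end

theory Submission
  imports Defs
begin

text \<open>
  Put \<open>U = opIm T\<close>, \<open>N = -U\<^sup>2\<close>, \<open>x = s - T\<^sub>0\<close>, \<open>y = q - T\<^sub>0\<close>. The operators \<open>T\<^sub>0\<close> and \<open>N\<close> are real, so they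
  commute with quaternions and with \<open>U\<close>, and \<open>Q\<^sub>c(s) = x\<^sup>2 + N\<close>. If \<open>L\<close> is the left-hand side, then
  \<open>L Q\<^sub>s(q) = (L q - s L) q - s* (L q - s L)\<close> with \<open>s*\<close> the conjugate of \<open>s\<close>, and
  \<open>L q - s L = L y - x L\<close>. Multiplying \<open>L y - x L\<close> by \<open>(x\<^sup>2 + N)\<^sup>2\<close> on the left and by \<open>(y\<^sup>2 + N)\<^sup>2\<close> on the
  right turns its equality with the difference of the two \<open>P\<^sub>2\<close> kernels into a polynomial identity in
  \<open>x\<close>, \<open>y\<close>, \<open>U\<close> with central \<open>N\<close>.

  That \<open>Q\<^sub>c(s)\<close> is invertible for \<open>s\<close> in the \<open>S\<close>-resolvent set follows from \<open>R R* = Q\<^sub>c(s) Q\<^sub>c(s*)\<close> with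
  \<open>R = T\<^sup>2 - 2 Re(s) T + |s|\<^sup>2\<close>: conjugation of operators reverses products when the components commute,
  so \<open>R*\<close> is invertible together with \<open>R\<close>.
\<close>

section \<open>Quaternions and real operators inside the operator ring\<close>

lemma lscale_conv_mult: "a \<rhd> f = (a \<rhd> 1) * f"
  by (rule qop_eqI) (simp add: lscale.rep_eq times_qop.rep_eq one_qop.rep_eq)

text \<open>As \<open>f \<lhd> a\<close> precomposes with left multiplication by \<open>a\<close>,
  both scalings become products with \<open>a \<rhd> 1\<close>, and all later calculations take
  place in the operator ring.\<close>

lemma rscale_conv_mult: "f \<lhd> a = f * (a \<rhd> 1)"
  by (rule qop_eqI) (simp add: lscale.rep_eq rscale.rep_eq times_qop.rep_eq one_qop.rep_eq)

lemma quat_op_mult: "((a * b) \<rhd> 1 :: 'x::banach qop) = (a \<rhd> 1) * (b \<rhd> 1)"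
  by (rule qop_eqI) (simp add: lscale.rep_eq times_qop.rep_eq one_qop.rep_eq lmult_mult)

lemma quat_op_mult_left: "(a \<rhd> 1) * ((b \<rhd> 1) * T) = ((a * b) \<rhd> 1) * T"
  by (simp add: quat_op_mult mult.assoc)

lemma quat_op_add: "((a + b) \<rhd> 1 :: 'x::banach qop) = (a \<rhd> 1) + (b \<rhd> 1)"
  by (rule qop_eqI) (auto simp: lscale.rep_eq plus_qop.rep_eq one_qop.rep_eq algebra_simps)

lemma quat_op_diff: "((a - b) \<rhd> 1 :: 'x::banach qop) = (a \<rhd> 1) - (b \<rhd> 1)"
  by (rule qop_eqI) (auto simp: lscale.rep_eq minus_qop.rep_eq one_qop.rep_eq algebra_simps)

lemma quat_op_of_real: "(of_real r \<rhd> 1 :: 'x::banach qop) = r *\<^sub>R 1"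
  by (rule qop_eqI) (simp add: lscale.rep_eq scaleR_qop.rep_eq one_qop.rep_eq mult_of_real)

lemma quat_op_one: "(1 \<rhd> 1 :: 'x::banach qop) = 1"
  by (rule qop_eqI) (simp add: lscale.rep_eq one_qop.rep_eq)

lemma quat_op_uminus: "((- a) \<rhd> 1 :: 'x::banach qop) = - (a \<rhd> 1)"
  by (rule qop_eqI) (auto simp: lscale.rep_eq uminus_qop.rep_eq one_qop.rep_eq)

lemma ext_mult: "ext (A o\<^sub>L B) = ext A * ext B"
  by (rule qop_eqI) (simp add: ext.rep_eq times_qop.rep_eq)

lemma ext_add: "ext (A + B) = ext A + ext B"
  by (rule qop_eqI) (simp add: ext.rep_eq plus_qop.rep_eq blinfun.add_left)

lemma ext_diff: "ext (A - B) = ext A - ext B"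
  by (rule qop_eqI) (simp add: ext.rep_eq minus_qop.rep_eq blinfun.diff_left)

lemma ext_uminus: "ext (- A) = - ext A"
  by (rule qop_eqI) (simp add: ext.rep_eq uminus_qop.rep_eq blinfun.minus_left)

lemma ext_scaleR: "ext (r *\<^sub>R A) = r *\<^sub>R ext A"
  by (rule qop_eqI) (simp add: ext.rep_eq scaleR_qop.rep_eq blinfun.scaleR_left)

lemma ext_zero: "ext 0 = 0"
  by (rule qop_eqI) (simp add: ext.rep_eq zero_qop.rep_eq zero_prod_def)

lemma ext_id: "ext id_blinfun = 1"
  by (rule qop_eqI) (simp add: ext.rep_eq one_qop.rep_eq)

text \<open>Left multiplication mixes the four components with real coefficients only, which the
  real linear map \<open>A\<close> respects.\<close>

lemma quat_op_ext: "(a \<rhd> 1) * ext A = ext A * (a \<rhd> 1)"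
  by (rule qop_eqI)
    (auto simp: ext.rep_eq times_qop.rep_eq lscale.rep_eq one_qop.rep_eq
      blinfun.add_right blinfun.diff_right blinfun.scaleR_right)

lemma quat_op_ext_left: "(a \<rhd> 1) * (ext A * T) = ext A * ((a \<rhd> 1) * T)"
  by (simp only: mult.assoc[symmetric] quat_op_ext)

section \<open>Components and commutation with real operators\<close>

definition comps :: "'x::banach qop \<Rightarrow> ('x \<Rightarrow>\<^sub>L 'x) set" where
  "comps T = {comp0 T, comp1 T, comp2 T, comp3 T}"

lemma comps_ext_mult:
  "comp0 (ext A * T) = A o\<^sub>L comp0 T" "comp1 (ext A * T) = A o\<^sub>L comp1 T"
  "comp2 (ext A * T) = A o\<^sub>L comp2 T" "comp3 (ext A * T) = A o\<^sub>L comp3 T"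
  by (rule blinfun_eqI, simp add: comp0.rep_eq comp1.rep_eq comp2.rep_eq comp3.rep_eq
      times_qop.rep_eq ext.rep_eq)+

lemma comps_mult_ext:
  "comp0 (T * ext A) = comp0 T o\<^sub>L A" "comp1 (T * ext A) = comp1 T o\<^sub>L A"
  "comp2 (T * ext A) = comp2 T o\<^sub>L A" "comp3 (T * ext A) = comp3 T o\<^sub>L A"
  by (rule blinfun_eqI, simp add: comp0.rep_eq comp1.rep_eq comp2.rep_eq comp3.rep_eq
      times_qop.rep_eq ext.rep_eq)+

text \<open>A factor \<open>ext A\<close> multiplies each component by \<open>A\<close> on the same
  side; conversely, it passes the units. This carries commutation from components to operators,
  inverses among them, and back.\<close>

lemma ext_commute_iff:
  "ext A * T = T * ext A \<longleftrightarrow> (\<forall>B\<in>comps T. A o\<^sub>L B = B o\<^sub>L A)"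
proof
  assume "ext A * T = T * ext A"
  then show "\<forall>B\<in>comps T. A o\<^sub>L B = B o\<^sub>L A"
    unfolding comps_def by (metis comps_ext_mult comps_mult_ext insert_iff singletonD)
next
  assume "\<forall>B\<in>comps T. A o\<^sub>L B = B o\<^sub>L A"
  then have *: "ext A * ext B = ext B * ext A" if "B \<in> comps T" for B
    using that by (simp flip: ext_mult)
  have **: "ext A * (ext B * (a \<rhd> 1)) = ext B * (a \<rhd> 1) * ext A" if "B \<in> comps T" for B a
    using *[OF that] by (metis mult.assoc quat_op_ext)
  show "ext A * T = T * ext A"
    by (subst (1 2) qop_decomp[of T])
      (simp add: rscale_conv_mult distrib_left distrib_right * ** comps_def)
qed

text \<open>Components are unique by \<open>comp_ext\<close>, so the witnesses in
  \<open>BC_def\<close> are those of \<open>T\<close>.\<close>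

lemma BC_iff: "T \<in> BC \<longleftrightarrow> (\<forall>A\<in>comps T. \<forall>B\<in>comps T. A o\<^sub>L B = B o\<^sub>L A)"
proof
  assume "T \<in> BC"
  then show "\<forall>A\<in>comps T. \<forall>B\<in>comps T. A o\<^sub>L B = B o\<^sub>L A"
    unfolding BC_def mem_Collect_eq comps_def by (elim exE conjE) (simp only: comp_ext)
next
  assume "\<forall>A\<in>comps T. \<forall>B\<in>comps T. A o\<^sub>L B = B o\<^sub>L A"
  then show "T \<in> BC"
    unfolding BC_def comps_def using qop_decomp[of T] by blast
qed

lemma BC_commute: "T \<in> BC \<Longrightarrow> A \<in> comps T \<Longrightarrow> ext A * T = T * ext A"
  by (simp add: BC_iff ext_commute_iff)

section \<open>Conjugation of operators\<close>

lemma comps_add: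
  "comp0 (S + T) = comp0 S + comp0 T" "comp1 (S + T) = comp1 S + comp1 T"
  "comp2 (S + T) = comp2 S + comp2 T" "comp3 (S + T) = comp3 S + comp3 T"
  by (rule blinfun_eqI, simp add: comp0.rep_eq comp1.rep_eq comp2.rep_eq comp3.rep_eq
      plus_qop.rep_eq blinfun.add_left)+

lemma comps_diff:
  "comp0 (S - T) = comp0 S - comp0 T" "comp1 (S - T) = comp1 S - comp1 T"
  "comp2 (S - T) = comp2 S - comp2 T" "comp3 (S - T) = comp3 S - comp3 T"
  by (rule blinfun_eqI, simp add: comp0.rep_eq comp1.rep_eq comp2.rep_eq comp3.rep_eq
      minus_qop.rep_eq blinfun.diff_left)+

lemma comps_scaleR:
  "comp0 (r *\<^sub>R T) = r *\<^sub>R comp0 T" "comp1 (r *\<^sub>R T) = r *\<^sub>R comp1 T"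
  "comp2 (r *\<^sub>R T) = r *\<^sub>R comp2 T" "comp3 (r *\<^sub>R T) = r *\<^sub>R comp3 T"
  by (rule blinfun_eqI, simp add: comp0.rep_eq comp1.rep_eq comp2.rep_eq comp3.rep_eq
      scaleR_qop.rep_eq blinfun.scaleR_left)+

lemma comps_one:
  "comp0 (1 :: 'x::banach qop) = id_blinfun" "comp1 (1 :: 'x qop) = 0"
  "comp2 (1 :: 'x qop) = 0" "comp3 (1 :: 'x qop) = 0"
  by (rule blinfun_eqI, simp add: comp0.rep_eq comp1.rep_eq comp2.rep_eq comp3.rep_eq one_qop.rep_eq)+

lemma opcnj_add: "opcnj (S + T) = opcnj S + opcnj T"
  by (simp add: opcnj_def comps_add ext_add rscale_conv_mult algebra_simps)

lemma opcnj_diff: "opcnj (S - T) = opcnj S - opcnj T"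
  by (simp add: opcnj_def comps_diff ext_diff rscale_conv_mult algebra_simps)

lemma opcnj_scaleR: "opcnj (r *\<^sub>R T) = r *\<^sub>R opcnj T"
  by (simp add: opcnj_def comps_scaleR ext_scaleR rscale_conv_mult scaleR_right_diff_distrib)

lemma opcnj_one: "opcnj 1 = 1"
  by (simp add: opcnj_def comps_one ext_id ext_zero rscale_conv_mult)

text \<open>The reversal rule of quaternion conjugation: commuting components behave like real
  coefficients.\<close>

lemma opcnj_mult:
  assumes "\<And>A B. A \<in> comps S \<Longrightarrow> B \<in> comps T \<Longrightarrow> A o\<^sub>L B = B o\<^sub>L A"
  shows "opcnj (S * T) = opcnj T * opcnj S"
proof -
  define a0 a1 a2 a3 where a: "a0 = comp0 S" "a1 = comp1 S" "a2 = comp2 S" "a3 = comp3 S"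
  define b0 b1 b2 b3 where b: "b0 = comp0 T" "b1 = comp1 T" "b2 = comp2 T" "b3 = comp3 T"
  note e = quat_op_mult[symmetric] quat_units quat_op_uminus quat_op_one
  have c: "ext B * ext A = ext A * ext B" if "A \<in> comps S" "B \<in> comps T" for A B
    using assms[OF that] by (simp flip: ext_mult)
  have c': "ext B * (ext A * Z) = ext A * (ext B * Z)" if "A \<in> comps S" "B \<in> comps T" for A B Z
    by (metis mult.assoc c[OF that])
  note norm = rscale_conv_mult ext_add ext_diff ext_mult e quat_op_mult_left quat_op_ext quat_op_ext_left algebra_simps
  have S: "S = ext a0 + ext a1 \<lhd> e1 + ext a2 \<lhd> e2 + ext a3 \<lhd> e3" unfolding a by (rule qop_decomp)
  have T: "T = ext b0 + ext b1 \<lhd> e1 + ext b2 \<lhd> e2 + ext b3 \<lhd> e3" unfolding b by (rule qop_decomp)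
  have "S * T = ext ((a0 o\<^sub>L b0) - (a1 o\<^sub>L b1) - (a2 o\<^sub>L b2) - (a3 o\<^sub>L b3))
     + ext ((a0 o\<^sub>L b1) + (a1 o\<^sub>L b0) + (a2 o\<^sub>L b3) - (a3 o\<^sub>L b2)) \<lhd> e1
     + ext ((a0 o\<^sub>L b2) - (a1 o\<^sub>L b3) + (a2 o\<^sub>L b0) + (a3 o\<^sub>L b1)) \<lhd> e2
     + ext ((a0 o\<^sub>L b3) + (a1 o\<^sub>L b2) - (a2 o\<^sub>L b1) + (a3 o\<^sub>L b0)) \<lhd> e3"
    by (subst S, subst T) (simp add: norm)
  note comps = comp_ext[OF this]
  have "opcnj T * opcnj S = (ext b0 - ext b1 \<lhd> e1 - ext b2 \<lhd> e2 - ext b3 \<lhd> e3)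
      * (ext a0 - ext a1 \<lhd> e1 - ext a2 \<lhd> e2 - ext a3 \<lhd> e3)"
    by (simp add: opcnj_def a b)
  moreover have "a0 \<in> comps S" "a1 \<in> comps S" "a2 \<in> comps S" "a3 \<in> comps S"
    "b0 \<in> comps T" "b1 \<in> comps T" "b2 \<in> comps T" "b3 \<in> comps T"
    by (simp_all add: comps_def a b)
  ultimately show ?thesis
    unfolding opcnj_def[of "S * T"] comps
    by (simp add: norm c c')
qed

section \<open>Invertibility in the operator ring\<close>

lemma op_inv_commute:
  assumes "op_invertible A" "A * C = C * A"
  shows "op_inv A * C = C * op_inv A"
  by (metis assms mult.assoc mult_1 mult_1_right op_inv)

text \<open>The components of \<open>R\<close> commute with \<open>R\<close>, hence with its inverse
  and the components of that; so \<open>opcnj_mult\<close> applies to both products of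
  \<open>R\<close> and its inverse.\<close>

lemma BC_opcnj_invertible:
  assumes "R \<in> BC" "op_invertible R"
  shows "op_invertible (opcnj R)"
proof -
  let ?B = "op_inv R"
  have "ext A * ?B = ?B * ext A" if "A \<in> comps R" for A
    using BC_commute[OF assms(1) that] op_inv_commute[OF assms(2)] by simp
  then have c: "A o\<^sub>L B = B o\<^sub>L A" if "A \<in> comps R" "B \<in> comps ?B" for A B
    using that unfolding ext_commute_iff by blast
  have "opcnj R * opcnj ?B = opcnj (?B * R)"
    by (rule opcnj_mult[symmetric]) (metis c)
  moreover have "opcnj ?B * opcnj R = opcnj (R * ?B)"
    by (rule opcnj_mult[symmetric]) (rule c)
  ultimately show ?thesis
    unfolding op_invertible_def by (metis op_inv[OF assms(2)] opcnj_one)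
qed

lemma op_invertible_factor:
  assumes "op_invertible (A * B)" "A * B = B * A"
  shows "op_invertible A"
proof -
  let ?M = "op_inv (A * B)"
  have r: "A * (B * ?M) = 1"
    using op_inv(1)[OF assms(1)] by (simp add: mult.assoc)
  have l: "?M * B * A = 1"
    using op_inv(2)[OF assms(1)] by (simp add: mult.assoc assms(2))
  have "?M * B = ?M * B * (A * (B * ?M))"
    by (simp add: r)
  also have "\<dots> = ?M * B * A * (B * ?M)"
    by (simp only: mult.assoc)
  also have "\<dots> = B * ?M"
    by (simp add: l)
  finally show ?thesis
    unfolding op_invertible_def using r l by metis
qed

lemma op_invertible_mult:
  assumes "op_invertible A" "op_invertible B"
  shows "op_invertible (A * B)"
proof -
  have "A * B * (op_inv B * op_inv A) = A * (B * op_inv B) * op_inv A"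
    "op_inv B * op_inv A * (A * B) = op_inv B * (op_inv A * A) * B"
    by (simp_all only: mult.assoc)
  then show ?thesis
    unfolding op_invertible_def using assms by (metis op_inv mult_1_right)
qed

section \<open>Two identities in noncommutative rings\<close>

text \<open>Both sides are the resultant of z^2 - p z + m, with roots \<open>S\<close> and
  \<open>S'\<close>, and z^2 - 2 T0 z + T0^2 + N, with roots \<open>T0 + U\<close> and
  \<open>T0 - U\<close>: the left evaluates the first at the roots of the second, the right the
  second at the roots of the first.\<close>

lemma resolvent_norm_identity:
  fixes S T0 U N :: "'a::{real_algebra,monoid_mult}" and p m :: real
  assumes SS: "S * S = p *\<^sub>R S - m *\<^sub>R 1" and UU: "U * U = - N"
    and c: "N * T0 = T0 * N" "U * T0 = T0 * U" "S * T0 = T0 * S" "U * N = N * U" "S * N = N * S"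
  defines "S' \<equiv> p *\<^sub>R 1 - S"
  shows "((T0 + U) * (T0 + U) - p *\<^sub>R (T0 + U) + m *\<^sub>R 1) * ((T0 - U) * (T0 - U) - p *\<^sub>R (T0 - U) + m *\<^sub>R 1)
     = ((S - T0) * (S - T0) + N) * ((S' - T0) * (S' - T0) + N)"
proof -
  have ca: "N * (T0 * Z) = T0 * (N * Z)" "U * (T0 * Z) = T0 * (U * Z)" "S * (T0 * Z) = T0 * (S * Z)"
    "U * (N * Z) = N * (U * Z)" "S * (N * Z) = N * (S * Z)" 
    "S * (S * Z) = (p *\<^sub>R S - m *\<^sub>R 1) * Z" "U * (U * Z) = - N * Z" for Z
    by (simp_all only: mult.assoc[symmetric] c SS UU)
  show ?thesis unfolding S'_def
    by (simp add: c ca SS UU algebra_simps)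
qed

text \<open>
  The left-hand side of the theorem is \<open>4 E\<close>, once its first two summands are brought to the form
  \<open>A\<^sup>2 (\<dots>) B\<^sup>2\<close> by \<open>A = A\<^sup>2 (x\<^sup>2 + N)\<close> and \<open>B = (y\<^sup>2 + N) B\<^sup>2\<close>.
\<close>

lemma F_resolvent_identity:
  fixes x y U N A B :: "'a::{ring,monoid_mult}"
  assumes UU: "U * U = - N" and c: "N * x = x * N" "N * y = y * N" "N * U = U * N"
    and A: "A * (x * x + N) = 1" "A * x = x * A"
    and B: "(y * y + N) * B = 1" "B * y = y * B"
  defines "W \<equiv> (x + U) * (y + U)" and "V \<equiv> (x + U) * U * (y + U)"
  defines "E \<equiv> A * A * (x * x * W * y + x * W * y * y - x * V * y + N * V) * (B * B)"
  shows "E * y - x * E = x * A * A * (x + U) - (y + U) * B * B * y"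
proof -
  have ca: "N * (x * Z) = x * (N * Z)" "N * (y * Z) = y * (N * Z)" "N * (U * Z) = U * (N * Z)" 
    "U * (U * Z) = - N * Z" for Z
    by (simp_all only: mult.assoc[symmetric] c UU)
  \<comment> \<open>As \<open>A\<close> commutes with \<open>x\<close> and \<open>B\<close> with
    \<open>y\<close>, the outer factors move onto the polynomial between the squares.\<close>
  have xE: "x * E = A * A * (x * (x * x * W * y + x * W * y * y - x * V * y + N * V)) * (B * B)"
    unfolding E_def by (metis A(2) mult.assoc)
  have Ey: "E * y = A * A * ((x * x * W * y + x * W * y * y - x * V * y + N * V) * y) * (B * B)"
    unfolding E_def by (metis B(2) mult.assoc)
  have "A * A * ((x * x + N) * (x * x + N)) = 1" "(y * y + N) * (y * y + N) * (B * B) = 1"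
    by (metis A(1) mult.assoc mult_1_right, metis B(1) mult.assoc mult_1)
  then have AB: "A * A = A * A * ((y * y + N) * (y * y + N) * (B * B))"
    "B * B = A * A * ((x * x + N) * (x * x + N)) * (B * B)"
    by simp_all
  have "E * y - x * E = A * A * ((x * x * W * y + x * W * y * y - x * V * y + N * V) * y
     - x * (x * x * W * y + x * W * y * y - x * V * y + N * V)) * (B * B)"
    unfolding xE Ey by (simp only: left_diff_distrib right_diff_distrib)
  \<comment> \<open>The terms x^2 W y^2 cancel; the rest reduces by \<open>UU\<close> and by moving
    \<open>N\<close> past \<open>x\<close>, \<open>y\<close> and \<open>U\<close>.\<close>
  also have "(x * x * W * y + x * W * y * y - x * V * y + N * V) * y
     - x * (x * x * W * y + x * W * y * y - x * V * y + N * V)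
    = x * (x + U) * ((y * y + N) * (y * y + N)) - (x * x + N) * (x * x + N) * ((y + U) * y)"
    unfolding W_def V_def by (simp add: c ca UU algebra_simps)
  also have "A * A * \<dots> * (B * B) = A * A * (x * (x + U)) * ((y * y + N) * (y * y + N) * (B * B))
     - A * A * ((x * x + N) * (x * x + N)) * ((y + U) * y * (B * B))"
    by (simp only: left_diff_distrib right_diff_distrib mult.assoc)
  also have "\<dots> = A * A * (x * (x + U)) - (y + U) * y * (B * B)"
    by (simp add: \<open>A * A * _ = 1\<close> \<open>_ * (B * B) = 1\<close>)
  also have "\<dots> = x * A * A * (x + U) - (y + U) * B * B * y"
    by (metis A(2) B(2) mult.assoc)
  finally show ?thesis .
qed

section \<open>Zeros of \<open>Q_s\<close>\<close>

text \<open>At a zero, (q0 - s0) Im(q) = 0. If q is real, the real part of the equation forces s =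
  q; otherwise s0 = q0 and it gives |Im(s)| = |Im(q)|. Both put s on the sphere of q.\<close>

lemma Q_s_nonzero:
  assumes "s \<notin> qsphere q"
  shows "Q_s s q \<noteq> 0"
proof
  assume Q: "Q_s s q = 0"
  have n: "(norm a)\<^sup>2 = (q0 a)\<^sup>2 + (q1 a)\<^sup>2 + (q2 a)\<^sup>2 + (q3 a)\<^sup>2" for a
    by (simp add: norm_quat_def)
  define r where "r = norm (qIm q)"
  have r: "r\<^sup>2 = (q1 q)\<^sup>2 + (q2 q)\<^sup>2 + (q3 q)\<^sup>2" "r \<ge> 0"
    by (simp_all add: r_def n qIm_def)
  have Q': "q0 (Q_s s q) = 0" "q1 (Q_s s q) = 0" "q2 (Q_s s q) = 0" "q3 (Q_s s q) = 0"
    by (simp_all add: Q)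
  have eqs: "(q0 q)\<^sup>2 - r\<^sup>2 - 2 * q0 s * q0 q + (norm s)\<^sup>2 = 0"
    "(q0 q - q0 s) * q1 q = 0" "(q0 q - q0 s) * q2 q = 0" "(q0 q - q0 s) * q3 q = 0"
    using Q' unfolding r by (simp_all add: Q_s_def of_real_def power2_eq_square[of q] power2_eq_square[of "q0 q"]
        power2_eq_square[of "q1 q"] power2_eq_square[of "q2 q"] power2_eq_square[of "q3 q"] algebra_simps)
  have "(q0 q - q0 s)\<^sup>2 * r\<^sup>2 = 0"
    using eqs(2-4) unfolding r by (auto simp: algebra_simps)
  then consider "r = 0" | "r \<noteq> 0" "q0 q = q0 s" by auto
  then show False
  proof cases
    case 1
    have "(q0 q - q0 s)\<^sup>2 + (q1 s)\<^sup>2 + (q2 s)\<^sup>2 + (q3 s)\<^sup>2 = 0"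
      using eqs(1) 1 by (simp add: n power2_diff algebra_simps)
    then have "q0 s = q0 q" "q1 s = 0" "q2 s = 0" "q3 s = 0"
      by (simp_all add: add_nonneg_eq_0_iff)
    \<comment> \<open>The radius is zero, so any imaginary unit serves as \<open>J\<close>.\<close>
    then have "s = of_real (q0 q) + e1 * of_real (norm (qIm q))"
      using 1 by (simp add: quat_eq_iff of_real_def r_def)
    moreover have "e1\<^sup>2 = -1" by (simp add: power2_eq_square quat_units)
    ultimately show False using assms unfolding qsphere_def by blast
  next
    case 2
    define J where "J = (1 / r) *\<^sub>R qIm s"
    have "(q1 s)\<^sup>2 + (q2 s)\<^sup>2 + (q3 s)\<^sup>2 = r\<^sup>2"
      using eqs(1) 2 n[of s] by (simp add: power2_eq_square)
    then have "J\<^sup>2 = -1"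
      using 2(1) by (simp add: J_def quat_eq_iff qIm_def power2_eq_square field_simps)
    moreover have "s = of_real (q0 q) + J * of_real (norm (qIm q))"
      unfolding r_def[symmetric] using 2 by (simp add: quat_eq_iff of_real_def J_def qIm_def)
    ultimately show False using assms unfolding qsphere_def by blast
  qed
qed

section \<open>Real and imaginary parts of operators\<close>

lemma opRe_plus_opIm: "T = opRe T + opIm T"
  by (subst qop_decomp) (simp add: opRe_def opIm_def)

lemma opcnj_eq: "opcnj T = opRe T - opIm T"
  by (simp add: opcnj_def opRe_def opIm_def)

lemma quat_op_opRe: "(a \<rhd> 1) * opRe T = opRe T * (a \<rhd> 1)"
  unfolding opRe_def by (rule quat_op_ext)

lemma commute_mult: "A * C = C * A \<Longrightarrow> B * C = C * B \<Longrightarrow> (A * B) * C = C * (A * B)"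
  for A B C :: "'a::semigroup_mult"
  by (metis mult.assoc)

lemma commute_add: "A * C = C * A \<Longrightarrow> B * C = C * B \<Longrightarrow> (A + B) * C = C * (A + B)"
  for A B C :: "'a::semiring"
  by (simp add: distrib_left distrib_right)

lemma commute_diff: "A * C = C * A \<Longrightarrow> B * C = C * B \<Longrightarrow> (A - B) * C = C * (A - B)"
  for A B C :: "'a::ring"
  by (simp add: left_diff_distrib right_diff_distrib)

lemma BC_opRe_opIm:
  assumes "T \<in> BC"
  shows "opIm T * opRe T = opRe T * opIm T"
proof -
  have "opRe T * T = T * opRe T"
    unfolding opRe_def by (rule BC_commute[OF assms]) (simp add: comps_def)
  then show ?thesis
    by (subst (asm) (2 3) opRe_plus_opIm) (simp add: algebra_simps)
qed

text \<open>Components commute while distinct units anticommute, so the mixed terms cancel and minus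
  the sum of the squares remains.\<close>

lemma BC_opIm_square:
  assumes "T \<in> BC"
  obtains A where "opIm T * opIm T = ext A"
proof
  let ?a = "comp1 T" and ?b = "comp2 T" and ?c = "comp3 T"
  note e = quat_op_mult[symmetric] quat_units quat_op_uminus quat_op_one
  have commute: "ext A * ext B = ext B * ext A" if "A \<in> comps T" "B \<in> comps T" for A B
    using assms that by (metis BC_iff ext_mult)
  have c: "ext ?b * ext ?a = ext ?a * ext ?b" "ext ?c * ext ?a = ext ?a * ext ?c"
    "ext ?c * ext ?b = ext ?b * ext ?c"
    by (rule commute, simp_all add: comps_def)+
  have c': "ext ?b * (ext ?a * Z) = ext ?a * (ext ?b * Z)" "ext ?c * (ext ?a * Z) = ext ?a * (ext ?c * Z)"
    "ext ?c * (ext ?b * Z) = ext ?b * (ext ?c * Z)" for Z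
    by (simp_all only: mult.assoc[symmetric] c)
  show "opIm T * opIm T = ext (- (?a o\<^sub>L ?a) - (?b o\<^sub>L ?b) - (?c o\<^sub>L ?c))"
    by (simp add: opIm_def rscale_conv_mult ext_uminus ext_diff ext_add ext_mult e quat_op_mult_left quat_op_ext quat_op_ext_left c c' algebra_simps)
qed

lemma quat_op_opIm_square:
  assumes "T \<in> BC"
  shows "(a \<rhd> 1) * (opIm T * opIm T) = opIm T * opIm T * (a \<rhd> 1)"
  by (metis BC_opIm_square[OF assms] quat_op_ext)

lemma BC_commutations:
  assumes "T \<in> BC"
  shows "- (opIm T * opIm T) * opRe T = opRe T * - (opIm T * opIm T)"
    "opIm T * opRe T = opRe T * opIm T"
    "(a \<rhd> 1) * opRe T = opRe T * (a \<rhd> 1)"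
    "opIm T * - (opIm T * opIm T) = - (opIm T * opIm T) * opIm T"
    "(a \<rhd> 1) * - (opIm T * opIm T) = - (opIm T * opIm T) * (a \<rhd> 1)"
  using commute_mult[OF BC_opRe_opIm BC_opRe_opIm, OF assms assms]
    quat_op_opIm_square[OF assms, of a] BC_opRe_opIm[OF assms]
  by (simp_all add: quat_op_opRe mult.assoc)

lemma quat_square: "a * a = (2 * q0 a) *\<^sub>R a - (norm a)\<^sup>2 *\<^sub>R 1"
  by (simp add: quat_eq_iff norm_quat_def power2_eq_square algebra_simps)

lemma quat_op_square:
  "(a \<rhd> 1) * (a \<rhd> 1) = (2 * q0 a) *\<^sub>R (a \<rhd> 1 :: 'x::banach qop) - (norm a)\<^sup>2 *\<^sub>R 1"
proof -
  have "(a \<rhd> 1) * (a \<rhd> 1) = ((of_real (2 * q0 a) * a - of_real ((norm a)\<^sup>2)) \<rhd> 1 :: 'x qop)"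
    unfolding quat_op_mult[symmetric] by (subst quat_square) (simp add: scaleR_conv_of_real)
  also have "\<dots> = (2 * q0 a) *\<^sub>R (a \<rhd> 1 :: 'x::banach qop) - (norm a)\<^sup>2 *\<^sub>R 1"
    unfolding quat_op_diff quat_op_mult quat_op_of_real by simp
  finally show ?thesis .
qed

lemma quat_op_qcnj: "(qcnj a \<rhd> 1) = (2 * q0 a) *\<^sub>R 1 - (a \<rhd> 1 :: 'x::banach qop)"
proof -
  have "qcnj a = of_real (2 * q0 a) - a"
    by (simp add: quat_eq_iff qcnj_def of_real_def)
  then show ?thesis
    by (simp only: quat_op_diff quat_op_of_real)
qed

section \<open>Invertibility of \<open>Q_c\<close> on the S-resolvent set\<close>

lemma Q_c_eq:
  assumes "T \<in> BC"
  shows "Q_c s T = ((s \<rhd> 1) - opRe T) * ((s \<rhd> 1) - opRe T) + - (opIm T * opIm T)"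
proof -
  have "T + opcnj T = opRe T + opRe T"
    by (subst (1) opRe_plus_opIm) (simp add: opcnj_eq)
  moreover have "T * opcnj T = (opRe T + opIm T) * (opRe T - opIm T)"
    by (metis opRe_plus_opIm opcnj_eq)
  ultimately show ?thesis
    unfolding Q_c_def lscale_conv_mult[of _ "_ + _"] power2_eq_square quat_op_mult
    by (simp add: algebra_simps BC_opRe_opIm[OF assms] quat_op_opRe)
qed

lemma op_invertible_Q_c:
  assumes T: "T \<in> BC" and s: "s \<in> rho_S T"
  shows "op_invertible (Q_c s T)"
proof -
  define T0 U N where "T0 = opRe T" "U = opIm T" "N = - (opIm T * opIm T)"
  define R where "R = T * T - (2 * q0 s) *\<^sub>R T + (norm s)\<^sup>2 *\<^sub>R 1"
  have "op_invertible R"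
    using s by (simp add: rho_S_def R_def power2_eq_square)
  have T_eq: "T = T0 + U" "opcnj T = T0 - U"
    using opRe_plus_opIm[of T] by (simp_all add: T0_U_N_def opcnj_eq)
  \<comment> \<open>Commutation is transferred twice: components of \<open>T\<close> commute with
    \<open>R\<close>, hence with the components of \<open>R\<close>; these then commute with
    \<open>T\<close> and so with \<open>R\<close>.\<close>
  have cT: "ext A * R = R * ext A" if "A \<in> comps T" for A
  proof -
    have "ext A * T = T * ext A" by (rule BC_commute[OF T that])
    moreover from this have "ext A * (T * T) = T * T * ext A" by (metis mult.assoc)
    ultimately show ?thesis by (simp add: R_def algebra_simps)
  qed
  then have "ext A * T = T * ext A" if "A \<in> comps R" for A
    using that unfolding ext_commute_iff by metis
  then have "ext A * R = R * ext A" if "A \<in> comps R" for A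
    using that unfolding R_def by (simp add: algebra_simps) (metis mult.assoc)
  then have "R \<in> BC"
    unfolding ext_commute_iff BC_iff by blast
  then have "op_invertible (opcnj R)"
    using \<open>op_invertible R\<close> by (rule BC_opcnj_invertible)
  have "opcnj (T * T) = opcnj T * opcnj T"
    using T by (intro opcnj_mult) (simp add: BC_iff)
  then have cR: "opcnj R = opcnj T * opcnj T - (2 * q0 s) *\<^sub>R opcnj T + (norm s)\<^sup>2 *\<^sub>R 1"
    by (simp add: R_def opcnj_add opcnj_diff opcnj_scaleR opcnj_one)
  note c = BC_commutations[OF T, folded T0_U_N_def]
  have "U * U = - N" by (simp add: T0_U_N_def)
  have Qc: "Q_c a T = ((a \<rhd> 1) - T0) * ((a \<rhd> 1) - T0) + N" for a
    by (simp add: Q_c_eq[OF T] T0_U_N_def)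
  \<comment> \<open>Stated for every \<open>a\<close> sharing real part and norm with
    \<open>s\<close>, so that it applies to the conjugate of \<open>s\<close> too. This shows that
    the two \<open>Q_c\<close> factors commute, and each is then invertible.\<close>
  have *: "R * opcnj R = Q_c a T * Q_c (qcnj a) T" if "q0 a = q0 s" "norm a = norm s" for a
    using resolvent_norm_identity[OF quat_op_square[of a] \<open>U * U = - N\<close> c]
    unfolding cR Qc unfolding R_def T_eq(2) unfolding T_eq(1) quat_op_qcnj that .
  have "R * opcnj R = Q_c s T * Q_c (qcnj s) T"
    by (rule *) simp_all
  moreover have "R * opcnj R = Q_c (qcnj s) T * Q_c s T"
    using *[of "qcnj s"] by (simp add: qcnj_def norm_quat_def)
  ultimately show ?thesis
    using op_invertible_mult[OF \<open>op_invertible R\<close> \<open>op_invertible (opcnj R)\<close>]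
    by (metis op_invertible_factor)
qed

theorem theorem4p4:
  fixes T :: "'x::banach qop" and q s :: quat
  assumes "T \<in> BC"
    and "q \<in> rho_S T" and "s \<in> rho_S T"
    and "s \<notin> qsphere q"
  shows "S_R_inv s T * P2_L q T + P2_R s T * S_L_inv q T
      - (1/4) *\<^sub>R (P2_R s T * opIm T * P2_L q T
                + P2_R s T * (opIm T)\<^sup>2 * F_L q T
                + F_R s T * (opIm T)\<^sup>2 * P2_L q T
                + F_R s T * (opIm T)^3 * F_L q T)
    = ((P2_R s T - P2_L q T) \<lhd> q - qcnj s \<rhd> (P2_R s T - P2_L q T)) \<lhd> inverse (Q_s s q)"
    (is "?L = _")
proof -
  define T0 U N where "T0 = opRe T" "U = opIm T" "N = - (opIm T * opIm T)"
  define S Q where "S = (s \<rhd> 1 :: 'x qop)" "Q = (q \<rhd> 1 :: 'x qop)"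
  define x y where "x = S - T0" "y = Q - T0"
  define A B where "A = op_inv (Q_c s T)" "B = op_inv (Q_c q T)"
  note c = BC_commutations[OF assms(1), folded T0_U_N_def]
  have UU: "U * U = - N" by (simp add: T0_U_N_def)
  have Qc: "Q_c s T = x * x + N" "Q_c q T = y * y + N"
    by (simp_all add: Q_c_eq[OF assms(1)] x_y_def S_Q_def T0_U_N_def)
  have inv: "op_invertible (x * x + N)" "op_invertible (y * y + N)"
    using op_invertible_Q_c[OF assms(1)] assms(2,3) by (simp_all flip: Qc)
  have AB: "A = op_inv (x * x + N)" "B = op_inv (y * y + N)"
    by (simp_all add: A_B_def Qc)
  have N: "N * x = x * N" "N * y = y * N" "N * U = U * N"
    using c by (simp_all add: x_y_def S_Q_def algebra_simps)
  have xQ: "(x * x + N) * x = x * (x * x + N)" "(y * y + N) * y = y * (y * y + N)"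
    using N by (simp_all add: algebra_simps)
  have T0: "x * T0 = T0 * x" "y * T0 = T0 * y"
    using c(3) by (simp_all add: x_y_def S_Q_def commute_diff)
  have "A * T0 = T0 * A" "B * T0 = T0 * B"
    unfolding AB by (intro op_inv_commute inv commute_add commute_mult c T0)+
  note T0 = T0 this
  have A: "A * (x * x + N) = 1" "A * x = x * A" and B: "(y * y + N) * B = 1" "B * y = y * B"
    unfolding AB using op_inv inv op_inv_commute xQ by blast+
  have cnj: "(a \<rhd> 1) - opcnj T = (a \<rhd> 1) - T0 + U" for a
    by (simp add: opcnj_eq T0_U_N_def)
  have S_eq: "S_R_inv s T = A * (x + U)" "S_L_inv q T = (y + U) * B"
    by (simp_all add: S_R_inv_def S_L_inv_def cnj A_B_def x_y_def S_Q_def)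
  have F_eq: "F_R s T = (-4) *\<^sub>R (A * A * (x + U))" "F_L q T = (-4) *\<^sub>R ((y + U) * (B * B))"
    by (simp_all add: F_R_def F_L_def cnj A_B_def x_y_def S_Q_def power2_eq_square)
  have P_eq: "P2_R s T = 4 *\<^sub>R (x * A * A * (x + U))"
    unfolding P2_R_def F_eq lscale_conv_mult[of s "_ *\<^sub>R _"]
    by (simp add: x_y_def S_Q_def T0_U_N_def algebra_simps)
  define G where "G = (y + U) * (B * B)"
  \<comment> \<open>In \<open>P2_L\<close> the quaternion acts from the right but \<open>T0\<close>
    from the left; moving \<open>T0\<close> across lets both merge into the right factor
    \<open>y\<close>.\<close>
  have "T0 * G = G * T0"
    unfolding G_def by (intro sym[OF commute_mult] commute_mult commute_add c T0)
  moreover have "P2_L q T = 4 *\<^sub>R (G * Q - T0 * G)"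
    unfolding P2_L_def F_eq(2)[folded G_def] rscale_conv_mult S_Q_def T0_U_N_def(1)
    by (simp add: algebra_simps)
  ultimately have P_eq': "P2_L q T = 4 *\<^sub>R ((y + U) * B * B * y)"
    \<comment> \<open>Expands only the last \<open>y\<close>, not the one in
      \<open>y + U\<close>.\<close>
    unfolding x_y_def(2)[THEN arg_cong[of y _ "(*) ((y + U) * B * B)"]]
    by (simp add: G_def right_diff_distrib mult.assoc)
  define W V where "W = (x + U) * (y + U)" "V = (x + U) * U * (y + U)"
  define E where "E = A * A * (x * x * W * y + x * W * y * y - x * V * y + N * V) * (B * B)"
  have E: "E * y - x * E = x * A * A * (x + U) - (y + U) * B * B * y"
    unfolding E_def W_V_def by (rule F_resolvent_identity[OF UU N A B])
  \<comment> \<open>Each \<open>P2\<close> kernel carries 4 and each \<open>F\<close> kernel -4;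
    with the factor 1/4 every summand has coefficient 4 up to sign. Powers of \<open>U\<close>
    reduce by U^2 = -N to \<open>W\<close> and \<open>V\<close>.\<close>
  have L: "?L = 4 *\<^sub>R E"
  proof -
    have xA: "x * (A * Z) = A * (x * Z)" and Nx: "N * (x * Z) = x * (N * Z)"
      and Ny: "N * (y * Z) = y * (N * Z)" and NxU: "N * ((x + U) * Z) = (x + U) * (N * Z)"
      and NyU: "N * ((y + U) * Z) = (y + U) * (N * Z)" and NU: "N * (U * Z) = U * (N * Z)"
      and UUZ: "U * (U * Z) = - (N * Z)" and By: "B * (y * Z) = y * (B * Z)" for Z
      by (simp_all only: mult.assoc[symmetric] A(2) B(2) N UU commute_add[OF N(1)[symmetric] N(3)[symmetric]]
          commute_add[OF N(2)[symmetric] N(3)[symmetric]] mult_minus_left)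
    note ac = W_V_def mult.assoc xA Nx Ny NxU NyU NU UUZ B(2) By
    have A': "A * Z = A * A * ((x * x + N) * Z)" for Z
      by (metis A(1) mult.assoc mult_1)
    have B': "Z * B = Z * (y * y + N) * (B * B)" for Z
      by (metis B(1) mult.assoc mult_1_right)
    have t1: "A * (x + U) * ((y + U) * B * B * y) = A * A * ((x * x + N) * W * y) * (B * B)"
      unfolding mult.assoc[of A "x + U"] by (subst A') (simp add: ac)
    have t2: "x * A * A * (x + U) * ((y + U) * B) = A * A * (x * W * (y * y + N)) * (B * B)"
      unfolding mult.assoc[of _ _ B, symmetric] by (subst B') (simp add: ac)
    have t3: "x * A * A * (x + U) * U * ((y + U) * B * B * y) = A * A * (x * V * y) * (B * B)"
      by (simp add: ac)
    have t4: "x * A * A * (x + U) * U\<^sup>2 * ((y + U) * (B * B)) = - (A * A * (N * x * W) * (B * B))"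
      by (simp add: ac power2_eq_square)
    have t5: "A * A * (x + U) * U\<^sup>2 * ((y + U) * B * B * y) = - (A * A * (N * W * y) * (B * B))"
      by (simp add: ac power2_eq_square)
    have t6: "A * A * (x + U) * U ^ 3 * ((y + U) * (B * B)) = - (A * A * (N * V) * (B * B))"
      by (simp add: ac power3_eq_cube)
    \<comment> \<open>The terms in N x W and N W y that arise from padding \<open>A\<close> and
      \<open>B\<close> to squares cancel here.\<close>
    have E': "E = A * A * ((x * x + N) * W * y) * (B * B) + A * A * (x * W * (y * y + N)) * (B * B)
        - (A * A * (x * V * y) * (B * B) + A * A * (N * x * W) * (B * B)
          + A * A * (N * W * y) * (B * B) - A * A * (N * V) * (B * B))"
      by (simp add: E_def distrib_left distrib_right left_diff_distrib right_diff_distrib mult.assoc)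
        (simp add: ac)
    show ?thesis
      unfolding S_eq P_eq P_eq' F_eq T0_U_N_def(2)[symmetric] mult_scaleR_left mult_scaleR_right
        t1 t2 t3 t4 t5 t6 E'
      by (simp add: scaleR_add_right scaleR_diff_right)
  qed
  \<comment> \<open>Thus the \<open>T0\<close> parts of \<open>x\<close> and \<open>y\<close> cancel
    in \<open>E * y - x * E\<close>.\<close>
  have "E * T0 = T0 * E"
    unfolding E_def W_V_def by (intro commute_mult commute_add commute_diff c T0)
  then have "E * y - x * E = E * Q - S * E"
    by (simp add: x_y_def left_diff_distrib right_diff_distrib)
  then have D: "P2_R s T - P2_L q T = ?L * Q - S * ?L"
    unfolding L unfolding P_eq P_eq' E[symmetric] scaleR_diff_right[symmetric]
    by (simp add: scaleR_diff_right)
  have "(P2_R s T - P2_L q T) \<lhd> q - qcnj s \<rhd> (P2_R s T - P2_L q T) = ?L * (Q_s s q \<rhd> 1)"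
  proof -
    have Q: "(Q_s s q \<rhd> 1) = Q * Q - (2 * q0 s) *\<^sub>R Q + (norm s)\<^sup>2 *\<^sub>R 1"
      unfolding Q_s_def quat_op_add quat_op_diff quat_op_mult quat_op_of_real power2_eq_square[of q] S_Q_def
      by simp
    have SS: "S * (S * Z) = (2 * q0 s) *\<^sub>R (S * Z) - (norm s)\<^sup>2 *\<^sub>R Z" for Z
      unfolding S_Q_def mult.assoc[symmetric] quat_op_square by (simp add: left_diff_distrib)
    show ?thesis
      \<comment> \<open>The products of L q with s and with its conjugate add up to 2 Re(s) L q, and
        the conjugate times s is |s|^2.\<close>
      unfolding rscale_conv_mult lscale_conv_mult[of "qcnj s"] quat_op_qcnj S_Q_def[symmetric] D Q
      by (simp add: algebra_simps SS)
  qed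
  then show ?thesis
    using Q_s_nonzero[OF assms(4)] by (simp add: rscale_conv_mult mult.assoc quat_op_one flip: quat_op_mult)
qed

end
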